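(* Let $(T,S,N)$ be a relative Rota-Baxter-Nijenhuis structure on a LieYRep pair $((\mathfrak g,[\cdot,\cdot],[\![\cdot,\cdot,\cdot]\!]),(V;\rho,\mu))$. Then for all $u,v,w\in V$ $$[u,v]^T_S=[u,v]^T_{\hat\rho},\qquad [\![u,v,w]\!]^T_S=[\![u,v,w]\!]^T_{\hat\mu}.$$
   Context: All vector spaces are finite-dimensional over a field $\mathbb K$ of characteristic $0$. A Lie-Yamaguti algebra is a vector space $\mathfrak g$ with a bilinear map $[\cdot,\cdot]:\wedge^2\mathfrak g\to\mathfrak g$ and a trilinear map $[\![\cdot,\cdot,\cdot]\!]:\wedge^2\mathfrak g\otimes\mathfrak g\to\mathfrak g$ such that for all $x,y,z,w,t\in\mathfrak g$: (1) $[[x,y],z]+[[y,z],x]+[[z,x],y]+[\![x,y,z]\!]+[\![y,z,x]\!]+[\![z,x,y]\!]=0$; (2) $[\![[x,y],z,w]\!]+[\![[y,z],x,w]\!]+[\![[z,x],y,w]\!]=0$; (3) $[\![x,y,[z,w]]\!]=[[\![x,y,z]\!],w]+[z,[\![x,y,w]\!]]$; (4) $[\![x,y,[\![z,w,t]\!]]\!]=[\![[\![x,y,z]\!],w,t]\!]+[\![z,[\![x,y,w]\!],t]\!]+[\![z,w,[\![x,y,t]\!]]\!]$. A representation $(V;\rho,\mu)$ of $\mathfrak g$ is a vector space $V$ with linear maps $\rho:\mathfrak g\to\mathfrak{gl}(V)$, $\mu:\otimes^2\mathfrak g\to\mathfrak{gl}(V)$ such that, with $D(x,y)=D_{\rho,\mu}(x,y):=\mu(y,x)-\mu(x,y)+[\rho(x),\rho(y)]-\rho([x,y])$,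 for all $x,y,z,w\in\mathfrak g$: $\mu([x,y],z)-\mu(x,z)\rho(y)+\mu(y,z)\rho(x)=0$; $\mu(x,[y,z])-\rho(y)\mu(x,z)+\rho(z)\mu(x,y)=0$; $\rho([\![x,y,z]\!])=[D(x,y),\rho(z)]$; $\mu(z,w)\mu(x,y)-\mu(y,w)\mu(x,z)-\mu(x,[\![y,z,w]\!])+D(y,z)\mu(x,w)=0$; $\mu([\![x,y,z]\!],w)+\mu(z,[\![x,y,w]\!])=[D(x,y),\mu(z,w)]$. A Lie-Yamaguti algebra together with a representation is called a LieYRep pair. Nijenhuis operator on a Lie-Yamaguti algebra: a linear map $N:\mathfrak g\to\mathfrak g$ such that, with $[x,y]_N=[Nx,y]+[x,Ny]-N[x,y]$ and $[\![x,y,z]\!]_N=[\![Nx,Ny,z]\!]+[\![x,Ny,Nz]\!]+[\![Nx,y,Nz]\!]-N([\![Nx,y,z]\!]+[\![x,Ny,z]\!]+[\![x,y,Nz]\!])+N^2[\![x,y,z]\!]$, one has $[Nx,Ny]=N[x,y]_N$ and $[\![Nx,Ny,Nz]\!]=N[\![x,y,z]\!]_N$. For $N\in\mathfrak{gl}(\mathfrak g)$, $S\in\mathfrak{gl}(V)$ put $\hat\rho(x)=\rho(Nx)+\rho(x)\circ S-S\circ\rho(x)$, $\hat\mu(x,y)=\mu(Nx,y)\circ S+\mu(x,Ny)\circ S+\mu(Nx,Ny)-S\circ(\mu(Nx,y)+\mu(x,Ny)+\mu(x,y)\circ S)+S^2\circ\mu(x,y)$, $\hat D(x,y)=D(Nx,y)\circ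 S+D(x,Ny)\circ S+D(Nx,Ny)-S\circ(D(Nx,y)+D(x,Ny)+D(x,y)\circ S)+S^2\circ D(x,y)$. Nijenhuis structure on a LieYRep pair: $(N,S)$ such that $N$ is a Nijenhuis operator on $\mathfrak g$ and $\rho(Nx)\circ S=S\circ\hat\rho(x)$, $\mu(Nx,Ny)\circ S=S\circ\hat\mu(x,y)$ for all $x,y\in\mathfrak g$. For a linear map $T:V\to\mathfrak g$ put $[u,v]^T=\rho(Tu)v-\rho(Tv)u$ and $[\![u,v,w]\!]^T=D(Tu,Tv)w+\mu(Tv,Tw)u-\mu(Tu,Tw)v$. $T$ is a relative Rota-Baxter operator on $\mathfrak g$ with respect to $(V;\rho,\mu)$ if $[Tu,Tv]=T[u,v]^T$ and $[\![Tu,Tv,Tw]\!]=T[\![u,v,w]\!]^T$ for all $u,v,w\in V$. Further, $[u,v]^T_S=[Su,v]^T+[u,Sv]^T-S[u,v]^T$; $[\![u,v,w]\!]^T_S=[\![Su,Sv,w]\!]^T+[\![Su,v,Sw]\!]^T+[\![u,Sv,Sw]\!]^T-S([\![Su,v,w]\!]^T+[\![u,Sv,w]\!]^T+[\![u,v,Sw]\!]^T)+S^2[\![u,v,w]\!]^T$; $[u,v]^T_{\hat\rho}=\hat\rho(Tu)v-\hat\rho(Tv)u$; $[\![u,v,w]\!]^T_{\hat\mu}=\hat D(Tu,Tv)w+\hat\mu(Tv,Tw)u-\hat\mu(Tu,Tw)v$. Relative Rota-Baxter-Nijenhuis structure: a triple $(T,S,N)$ where $(N,S)$ is a Nijenhuis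 structure on the pair, $T$ is a relative Rota-Baxter operator, and for all $u,v,w\in V$: $N\circ T=T\circ S$, $[u,v]^T_S=[u,v]^{N\circ T}$, $[\![u,v,w]\!]^T_S=[\![u,v,w]\!]^{N\circ T}$. *)

theory Defs
  imports Complex_Main
begin

text \<open>
  Vector spaces are given by scalar multiplications on whole types, in the sense of the locale
  \<^locale>\<open>finite_dimensional_vector_space\<close>; its basis parameter is quantified existentially, so
  that only finite dimensionality is assumed.  Identities between operators in \<open>gl(V)\<close> are written
  pointwise, that is, applied to a vector \<open>v\<close>.
\<close>

text \<open>\<open>D(x,y) = \<mu>(y,x) - \<mu>(x,y) + [\<rho>(x),\<rho>(y)] - \<rho>([x,y])\<close>\<close>

definition rep_D ::
  "('g \<Rightarrow> 'g \<Rightarrow> 'g) \<Rightarrow> ('g \<Rightarrow> 'v \<Rightarrow> 'v) \<Rightarrow> ('g \<Rightarrow> 'g \<Rightarrow> 'v \<Rightarrow> 'v) \<Rightarrow> 'g \<Rightarrow> 'g \<Rightarrow> 'v \<Rightarrow> 'v::ab_group_add"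
  where "rep_D br \<rho> \<mu> x y v =
    \<mu> y x v - \<mu> x y v + (\<rho> x (\<rho> y v) - \<rho> y (\<rho> x v)) - \<rho> (br x y) v"

text \<open>The wedge products in the types of the brackets are rendered by the alternating laws.\<close>

locale lie_yamaguti_algebra =
  fixes sg :: "'k::field_char_0 \<Rightarrow> 'g::ab_group_add \<Rightarrow> 'g"
    and br :: "'g \<Rightarrow> 'g \<Rightarrow> 'g"
    and tr :: "'g \<Rightarrow> 'g \<Rightarrow> 'g \<Rightarrow> 'g"
  assumes fin_dim: "\<exists>B. finite_dimensional_vector_space sg B"
    and br_linear1: "\<And>y. Vector_Spaces.linear sg sg (\<lambda>x. br x y)"
    and br_linear2: "\<And>x. Vector_Spaces.linear sg sg (\<lambda>y. br x y)"
    and br_alternating: "\<And>x. br x x = 0"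
    and tr_linear1: "\<And>y z. Vector_Spaces.linear sg sg (\<lambda>x. tr x y z)"
    and tr_linear2: "\<And>x z. Vector_Spaces.linear sg sg (\<lambda>y. tr x y z)"
    and tr_linear3: "\<And>x y. Vector_Spaces.linear sg sg (\<lambda>z. tr x y z)"
    and tr_alternating: "\<And>x z. tr x x z = 0"
    and LY1: "\<And>x y z. br (br x y) z + br (br y z) x + br (br z x) y
                + tr x y z + tr y z x + tr z x y = 0"
    and LY2: "\<And>x y z w. tr (br x y) z w + tr (br y z) x w + tr (br z x) y w = 0"
    and LY3: "\<And>x y z w. tr x y (br z w) = br (tr x y z) w + br z (tr x y w)"
    and LY4: "\<And>x y z w t. tr x y (tr z w t) =
                tr (tr x y z) w t + tr z (tr x y w) t + tr z w (tr x y t)"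

locale LieYRep_pair = lie_yamaguti_algebra sg br tr
  for sg :: "'k::field_char_0 \<Rightarrow> 'g::ab_group_add \<Rightarrow> 'g"
    and br :: "'g \<Rightarrow> 'g \<Rightarrow> 'g"
    and tr :: "'g \<Rightarrow> 'g \<Rightarrow> 'g \<Rightarrow> 'g" +
  fixes sV :: "'k \<Rightarrow> 'v::ab_group_add \<Rightarrow> 'v"
    and \<rho> :: "'g \<Rightarrow> 'v \<Rightarrow> 'v"
    and \<mu> :: "'g \<Rightarrow> 'g \<Rightarrow> 'v \<Rightarrow> 'v"
  assumes fin_dim_V: "\<exists>B. finite_dimensional_vector_space sV B"
    and \<rho>_gl: "\<And>x. Vector_Spaces.linear sV sV (\<rho> x)"
    and \<rho>_linear: "\<And>v. Vector_Spaces.linear sg sV (\<lambda>x. \<rho> x v)"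
    and \<mu>_gl: "\<And>x y. Vector_Spaces.linear sV sV (\<mu> x y)"
    and \<mu>_linear1: "\<And>y v. Vector_Spaces.linear sg sV (\<lambda>x. \<mu> x y v)"
    and \<mu>_linear2: "\<And>x v. Vector_Spaces.linear sg sV (\<lambda>y. \<mu> x y v)"
    and rep1: "\<And>x y z v. \<mu> (br x y) z v - \<mu> x z (\<rho> y v) + \<mu> y z (\<rho> x v) = 0"
    and rep2: "\<And>x y z v. \<mu> x (br y z) v - \<rho> y (\<mu> x z v) + \<rho> z (\<mu> x y v) = 0"
    and rep3: "\<And>x y z v. \<rho> (tr x y z) v =
                 rep_D br \<rho> \<mu> x y (\<rho> z v) - \<rho> z (rep_D br \<rho> \<mu> x y v)"
    and rep4: "\<And>x y z w v. \<mu> z w (\<mu> x y v) - \<mu> y w (\<mu> x z v) - \<mu> x (tr y z w) v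
                 + rep_D br \<rho> \<mu> y z (\<mu> x w v) = 0"
    and rep5: "\<And>x y z w v. \<mu> (tr x y z) w v + \<mu> z (tr x y w) v =
                 rep_D br \<rho> \<mu> x y (\<mu> z w v) - \<mu> z w (rep_D br \<rho> \<mu> x y v)"

text \<open>
  The brackets deformed by an endomorphism: \<open>[x,y]\<^sub>N\<close> and its ternary version on \<open>\<gg>\<close>, as well as
  \<open>[u,v]\<^sup>T\<^sub>S\<close> and its ternary version on \<open>V\<close>, are instances of the same two formulas.
\<close>

definition deform2 :: "('a \<Rightarrow> 'a) \<Rightarrow> ('a \<Rightarrow> 'a \<Rightarrow> 'a) \<Rightarrow> 'a \<Rightarrow> 'a \<Rightarrow> 'a::ab_group_add"
  where "deform2 N b x y = b (N x) y + b x (N y) - N (b x y)"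

definition deform3 ::
  "('a \<Rightarrow> 'a) \<Rightarrow> ('a \<Rightarrow> 'a \<Rightarrow> 'a \<Rightarrow> 'a) \<Rightarrow> 'a \<Rightarrow> 'a \<Rightarrow> 'a \<Rightarrow> 'a::ab_group_add"
  where "deform3 N t x y z =
    t (N x) (N y) z + t x (N y) (N z) + t (N x) y (N z)
    - N (t (N x) y z + t x (N y) z + t x y (N z))
    + N (N (t x y z))"

definition nijenhuis_operator ::
  "('k::field_char_0 \<Rightarrow> 'g::ab_group_add \<Rightarrow> 'g) \<Rightarrow> ('g \<Rightarrow> 'g \<Rightarrow> 'g) \<Rightarrow> ('g \<Rightarrow> 'g \<Rightarrow> 'g \<Rightarrow> 'g)
    \<Rightarrow> ('g \<Rightarrow> 'g) \<Rightarrow> bool"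
  where "nijenhuis_operator sg br tr N \<longleftrightarrow>
    Vector_Spaces.linear sg sg N \<and>
    (\<forall>x y. br (N x) (N y) = N (deform2 N br x y)) \<and>
    (\<forall>x y z. tr (N x) (N y) (N z) = N (deform3 N tr x y z))"

definition rho_hat ::
  "('g \<Rightarrow> 'v \<Rightarrow> 'v) \<Rightarrow> ('g \<Rightarrow> 'g) \<Rightarrow> ('v \<Rightarrow> 'v) \<Rightarrow> 'g \<Rightarrow> 'v \<Rightarrow> 'v::ab_group_add"
  where "rho_hat \<rho> N S x v = \<rho> (N x) v + \<rho> x (S v) - S (\<rho> x v)"

text \<open>The maps \<open>\<mu>\<close> and \<open>D\<close> are deformed by the same formula, here stated for a bilinear map \<open>\<phi>\<close>.\<close>

definition bi_hat ::
  "('g \<Rightarrow> 'g \<Rightarrow> 'v \<Rightarrow> 'v) \<Rightarrow> ('g \<Rightarrow> 'g) \<Rightarrow> ('v \<Rightarrow> 'v) \<Rightarrow> 'g \<Rightarrow> 'g \<Rightarrow> 'v \<Rightarrow> 'v::ab_group_add"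
  where "bi_hat \<phi> N S x y v =
    \<phi> (N x) y (S v) + \<phi> x (N y) (S v) + \<phi> (N x) (N y) v
    - S (\<phi> (N x) y v + \<phi> x (N y) v + \<phi> x y (S v))
    + S (S (\<phi> x y v))"

abbreviation mu_hat ::
  "('g \<Rightarrow> 'g \<Rightarrow> 'v \<Rightarrow> 'v) \<Rightarrow> ('g \<Rightarrow> 'g) \<Rightarrow> ('v \<Rightarrow> 'v) \<Rightarrow> 'g \<Rightarrow> 'g \<Rightarrow> 'v \<Rightarrow> 'v::ab_group_add"
  where "mu_hat \<mu> N S \<equiv> bi_hat \<mu> N S"

abbreviation D_hat ::
  "('g \<Rightarrow> 'g \<Rightarrow> 'g) \<Rightarrow> ('g \<Rightarrow> 'v \<Rightarrow> 'v) \<Rightarrow> ('g \<Rightarrow> 'g \<Rightarrow> 'v \<Rightarrow> 'v) \<Rightarrow> ('g \<Rightarrow> 'g) \<Rightarrow> ('v \<Rightarrow> 'v)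
    \<Rightarrow> 'g \<Rightarrow> 'g \<Rightarrow> 'v \<Rightarrow> 'v::ab_group_add"
  where "D_hat br \<rho> \<mu> N S \<equiv> bi_hat (rep_D br \<rho> \<mu>) N S"

locale nijenhuis_structure = LieYRep_pair sg br tr sV \<rho> \<mu>
  for sg :: "'k::field_char_0 \<Rightarrow> 'g::ab_group_add \<Rightarrow> 'g"
    and br :: "'g \<Rightarrow> 'g \<Rightarrow> 'g"
    and tr :: "'g \<Rightarrow> 'g \<Rightarrow> 'g \<Rightarrow> 'g"
    and sV :: "'k \<Rightarrow> 'v::ab_group_add \<Rightarrow> 'v"
    and \<rho> :: "'g \<Rightarrow> 'v \<Rightarrow> 'v"
    and \<mu> :: "'g \<Rightarrow> 'g \<Rightarrow> 'v \<Rightarrow> 'v" +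
  fixes N :: "'g \<Rightarrow> 'g"
    and S :: "'v \<Rightarrow> 'v"
  assumes nijenhuis_N: "nijenhuis_operator sg br tr N"
    and S_gl: "Vector_Spaces.linear sV sV S"
    and nijenhuis_\<rho>: "\<And>x v. \<rho> (N x) (S v) = S (rho_hat \<rho> N S x v)"
    and nijenhuis_\<mu>: "\<And>x y v. \<mu> (N x) (N y) (S v) = S (mu_hat \<mu> N S x y v)"

text \<open>
  The brackets on \<open>V\<close> induced by \<open>T\<close>.  In the ternary one the map \<open>D\<close> is an argument of its own:
  it is \<^term>\<open>rep_D br \<rho> \<mu>\<close> for the bracket of the pair and \<^term>\<open>D_hat br \<rho> \<mu> N S\<close> for the hatted
  bracket.
\<close>

definition induced2 ::
  "('g \<Rightarrow> 'v \<Rightarrow> 'v) \<Rightarrow> ('v \<Rightarrow> 'g) \<Rightarrow> 'v \<Rightarrow> 'v \<Rightarrow> 'v::ab_group_add"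
  where "induced2 \<rho> T u v = \<rho> (T u) v - \<rho> (T v) u"

definition induced3 ::
  "('g \<Rightarrow> 'g \<Rightarrow> 'v \<Rightarrow> 'v) \<Rightarrow> ('g \<Rightarrow> 'g \<Rightarrow> 'v \<Rightarrow> 'v) \<Rightarrow> ('v \<Rightarrow> 'g)
    \<Rightarrow> 'v \<Rightarrow> 'v \<Rightarrow> 'v \<Rightarrow> 'v::ab_group_add"
  where "induced3 D \<mu> T u v w = D (T u) (T v) w + \<mu> (T v) (T w) u - \<mu> (T u) (T w) v"

definition relative_rota_baxter ::
  "('k::field_char_0 \<Rightarrow> 'g::ab_group_add \<Rightarrow> 'g) \<Rightarrow> ('g \<Rightarrow> 'g \<Rightarrow> 'g) \<Rightarrow> ('g \<Rightarrow> 'g \<Rightarrow> 'g \<Rightarrow> 'g)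
    \<Rightarrow> ('k \<Rightarrow> 'v::ab_group_add \<Rightarrow> 'v) \<Rightarrow> ('g \<Rightarrow> 'v \<Rightarrow> 'v) \<Rightarrow> ('g \<Rightarrow> 'g \<Rightarrow> 'v \<Rightarrow> 'v)
    \<Rightarrow> ('v \<Rightarrow> 'g) \<Rightarrow> bool"
  where "relative_rota_baxter sg br tr sV \<rho> \<mu> T \<longleftrightarrow>
    Vector_Spaces.linear sV sg T \<and>
    (\<forall>u v. br (T u) (T v) = T (induced2 \<rho> T u v)) \<and>
    (\<forall>u v w. tr (T u) (T v) (T w) = T (induced3 (rep_D br \<rho> \<mu>) \<mu> T u v w))"

locale relative_rota_baxter_nijenhuis = nijenhuis_structure sg br tr sV \<rho> \<mu> N S
  for sg :: "'k::field_char_0 \<Rightarrow> 'g::ab_group_add \<Rightarrow> 'g"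
    and br :: "'g \<Rightarrow> 'g \<Rightarrow> 'g"
    and tr :: "'g \<Rightarrow> 'g \<Rightarrow> 'g \<Rightarrow> 'g"
    and sV :: "'k \<Rightarrow> 'v::ab_group_add \<Rightarrow> 'v"
    and \<rho> :: "'g \<Rightarrow> 'v \<Rightarrow> 'v"
    and \<mu> :: "'g \<Rightarrow> 'g \<Rightarrow> 'v \<Rightarrow> 'v"
    and T :: "'v \<Rightarrow> 'g"
    and S :: "'v \<Rightarrow> 'v"
    and N :: "'g \<Rightarrow> 'g" +
  assumes rota_baxter_T: "relative_rota_baxter sg br tr sV \<rho> \<mu> T"
    and NT_eq_TS: "N \<circ> T = T \<circ> S"
    and deform2_eq: "\<And>u v. deform2 S (induced2 \<rho> T) u v = induced2 \<rho> (N \<circ> T) u v"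
    and deform3_eq: "\<And>u v w. deform3 S (induced3 (rep_D br \<rho> \<mu>) \<mu> T) u v w
                       = induced3 (rep_D br \<rho> \<mu>) \<mu> (N \<circ> T) u v w"

end

theory Submission
  imports Defs
begin

text \<open>
  Both identities are matters of bookkeeping once \<open>N \<circ> T = T \<circ> S\<close> is known.  An induced bracket feeds
  its arguments into the action through \<open>T\<close>, except for one that is acted on.  Deforming the bracket
  inserts \<open>S\<close> into the arguments: in an argument that goes through \<open>T\<close> it turns into an \<open>N\<close> in front of
  \<open>T\<close>, and in the one that is acted on it remains an \<open>S\<close>.  For each summand of the bracket this produces
  precisely the placements of \<open>N\<close> and \<open>S\<close> in the hatted action.  The outer factors \<open>S\<close> and \<open>S\<^sup>2\<close> agree
  as well, because \<open>S\<close> is additive and therefore distributes over the summands of the bracket.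
\<close>

lemma deform2_induced2_eq_induced2_rho_hat:
  assumes S: "additive S" and NT: "N \<circ> T = T \<circ> S"
  shows "deform2 S (induced2 \<rho> T) u v = induced2 (rho_hat \<rho> N S) T u v"
proof -
  have "T (S a) = N (T a)" for a
    using fun_cong[OF NT, of a] by simp
  then show ?thesis
    by (simp add: deform2_def induced2_def rho_hat_def additive.diff[OF S])
qed

text \<open>
  The summands with \<open>D\<close> and those with \<open>\<mu>\<close> are matched separately, so the identity holds for unrelated
  \<open>D\<close> and \<open>\<mu>\<close>.
\<close>

lemma deform3_induced3_eq_induced3_bi_hat:
  assumes S: "additive S" and NT: "N \<circ> T = T \<circ> S"
  shows "deform3 S (induced3 D \<mu> T) u v w = induced3 (bi_hat D N S) (bi_hat \<mu> N S) T u v w"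
proof -
  have "T (S a) = N (T a)" for a
    using fun_cong[OF NT, of a] by simp
  then show ?thesis
    by (simp add: deform3_def induced3_def bi_hat_def additive.diff[OF S] additive.add[OF S])
qed

theorem lemma4p4:
  fixes sg :: "'k::field_char_0 \<Rightarrow> 'g::ab_group_add \<Rightarrow> 'g"
    and br :: "'g \<Rightarrow> 'g \<Rightarrow> 'g"
    and tr :: "'g \<Rightarrow> 'g \<Rightarrow> 'g \<Rightarrow> 'g"
    and sV :: "'k \<Rightarrow> 'v::ab_group_add \<Rightarrow> 'v"
    and \<rho> :: "'g \<Rightarrow> 'v \<Rightarrow> 'v"
    and \<mu> :: "'g \<Rightarrow> 'g \<Rightarrow> 'v \<Rightarrow> 'v"
    and T :: "'v \<Rightarrow> 'g"
    and S :: "'v \<Rightarrow> 'v"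
    and N :: "'g \<Rightarrow> 'g"
  assumes "relative_rota_baxter_nijenhuis sg br tr sV \<rho> \<mu> T S N"
  shows "\<forall>u v w.
    deform2 S (induced2 \<rho> T) u v = induced2 (rho_hat \<rho> N S) T u v \<and>
    deform3 S (induced3 (rep_D br \<rho> \<mu>) \<mu> T) u v w
      = induced3 (D_hat br \<rho> \<mu> N S) (mu_hat \<mu> N S) T u v w"
proof -
  interpret relative_rota_baxter_nijenhuis sg br tr sV \<rho> \<mu> T S N
    by (fact assms)
  have "additive S"
    using S_gl by (simp add: additive_def Vector_Spaces.linear_iff)
  then show ?thesis
    using NT_eq_TS deform2_induced2_eq_induced2_rho_hat deform3_induced3_eq_induced3_bi_hat by blast
qed

end
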